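(* Let $H$ be a limit sparse semigroup of genus $g$ with odd Frobenius number $\ell_g=2g-(2r+1)=6r+1$, where $r\in\mathbb{N}$. If the multiplicity $n_1$ of $H$ is even, then every nongap of $H$ smaller than $\ell_g$ is even, and so $H$ is $r$-hyperelliptic.
   Context: $\mathbb{N}$ is the set of natural numbers including $0$. A numerical semigroup $H\subseteq\mathbb{N}$ of genus $g\ge 1$ is a subset containing $0$, closed under addition, whose complement $\mathbb{N}\setminus H=\{1=\ell_1<\ell_2<\dots<\ell_g\}$ has exactly $g$ elements, called gaps; elements of $H$ are called nongaps, $\ell_g$ is the Frobenius number, and the smallest positive nongap is the multiplicity. $H$ is sparse if $\ell_i-\ell_{i-1}\le 2$ for all $i=2,\dots,g$. A sparse semigroup is a limit sparse semigroup if the number of indices $i\in\{1,\dots,g-1\}$ with $\ell_{i+1}-\ell_i=1$ equals the number of indices $i\in\{1,\dots,g-1\}$ with $\ell_{i+1}-\ell_i=2$; equivalently, $g=2\kappa-1$ where $\kappa:=2g-\ell_g$ (so for $\ell_g=2g-(2r+1)$ one has $g=4r+1$ and $\ell_g=6r+1$). A numerical semigroup is $\gamma$-hyperelliptic if it has exactly $\gamma$ even gaps. *)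

theory Defs
  imports Main
begin

definition numerical_semigroup :: "nat set \<Rightarrow> bool" where
  "numerical_semigroup H \<longleftrightarrow>
     0 \<in> H \<and> (\<forall>x\<in>H. \<forall>y\<in>H. x + y \<in> H) \<and> finite (UNIV - H)"

definition gaps :: "nat set \<Rightarrow> nat set" where
  "gaps H = UNIV - H"

definition genus :: "nat set \<Rightarrow> nat" where
  "genus H = card (gaps H)"

text \<open>The gaps are indexed from 1, as in \<open>\<ell>\<^sub>1 < \<dots> < \<ell>\<^sub>g\<close>;
  \<open>gap H i\<close> is meaningful only for \<open>1 \<le> i \<le> genus H\<close>.\<close>

definition gap :: "nat set \<Rightarrow> nat \<Rightarrow> nat" where
  "gap H i = sorted_list_of_set (gaps H) ! (i - 1)"

text \<open>Meaningful only for positive genus.\<close>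

definition frobenius_number :: "nat set \<Rightarrow> nat" where
  "frobenius_number H = gap H (genus H)"

definition semigroup_multiplicity :: "nat set \<Rightarrow> nat" where
  "semigroup_multiplicity H = (LEAST n. n \<in> H \<and> 0 < n)"

text \<open>Since \<open>gap H\<close> is increasing on the relevant indices, the natural-number
  subtractions below do not truncate.\<close>

definition sparse_semigroup :: "nat set \<Rightarrow> bool" where
  "sparse_semigroup H \<longleftrightarrow>
     numerical_semigroup H \<and> (\<forall>i\<in>{2..genus H}. gap H i - gap H (i - 1) \<le> 2)"

definition limit_sparse_semigroup :: "nat set \<Rightarrow> bool" where
  "limit_sparse_semigroup H \<longleftrightarrow>
     sparse_semigroup H \<and>
     card {i \<in> {1..genus H - 1}. gap H (i + 1) - gap H i = 1} =
     card {i \<in> {1..genus H - 1}. gap H (i + 1) - gap H i = 2}"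

definition hyperelliptic_semigroup :: "nat \<Rightarrow> nat set \<Rightarrow> bool" where
  "hyperelliptic_semigroup \<gamma> H \<longleftrightarrow>
     numerical_semigroup H \<and> card {x \<in> gaps H. even x} = \<gamma>"

end

theory Submission
  imports Defs
begin

text \<open>Let \<open>F\<close> be the Frobenius number, \<open>n\<close> the multiplicity and \<open>C = H \<union> (H + 1)\<close>. Since
  \<open>H + C \<subseteq> C\<close>, for every \<open>z \<notin> C\<close> the sets \<open>H\<close> and \<open>z - C\<close> are disjoint in \<open>[0, z]\<close>.
  Sparseness makes \<open>C\<close> twice as dense as \<open>H\<close>, and the limit condition says that \<open>H\<close> has density
  one third below \<open>F\<close>, so this disjointness is nearly tight. Take the last \<open>z \<notin> C\<close> below \<open>F\<close>.
  From \<open>z\<close> to \<open>F\<close> gaps and nongaps alternate, the nongaps being even. Comparing \<open>H\<close> and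
  \<open>z - C\<close> outside the top \<open>n\<close> elements of \<open>[0, z]\<close>, where \<open>z - C\<close> has only two elements
  and \<open>H\<close> fewer than half, yields \<open>F - z \<ge> n\<close>. An odd nongap below \<open>F\<close> can then be moved by
  multiples of the even number \<open>n\<close> into the alternating stretch, which is impossible.\<close>

text \<open>Cut the interval into \<open>k\<close> pairs of neighbours: each pair contains at most
  one element of \<open>S\<close>, so halving the distance to \<open>a\<close> is injective on
  \<open>S\<close>.\<close>

lemma card_no_consecutive_le:
  fixes S :: "nat set"
  assumes "S \<subseteq> {a..<a + 2 * k}" and "\<And>x. x \<in> S \<Longrightarrow> Suc x \<notin> S"
  shows "card S \<le> k"
proof -
  have "inj_on (\<lambda>x. (x - a) div 2) S"
  proof (rule inj_onI)
    fix x y assume S: "x \<in> S" "y \<in> S" and eq: "(x - a) div 2 = (y - a) div 2"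
    then obtain u v where uv: "x = a + u" "y = a + v"
      using assms(1) by (metis atLeastLessThan_iff le_iff_add subsetD)
    with eq have "u div 2 = v div 2" by simp
    then have "u = v \<or> u = Suc v \<or> v = Suc u" by linarith
    with uv have "x = y \<or> x = Suc y \<or> y = Suc x" by auto
    then show "x = y" using assms(2) S by auto
  qed
  moreover have "(\<lambda>x. (x - a) div 2) ` S \<subseteq> {..<k}"
    using assms(1) by fastforce
  ultimately have "card S \<le> card {..<k}"
    by (intro card_inj_on_le) auto
  then show ?thesis by simp
qed

lemma frobenius_number_eq_Max:
  assumes "finite (gaps H)" and "gaps H \<noteq> {}"
  shows "frobenius_number H = Max (gaps H)"
proof -
  let ?xs = "sorted_list_of_set (gaps H)"
  have "?xs \<noteq> []" using assms by simp
  then have "frobenius_number H = last ?xs"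
    by (simp add: frobenius_number_def gap_def genus_def last_conv_nth)
  also have "last ?xs = Max (gaps H)"
  proof (rule Max_eqI[symmetric])
    show "y \<le> last ?xs" if "y \<in> gaps H" for y
    proof -
      have "y \<in> set ?xs" using that assms(1) by simp
      then obtain j where "j < length ?xs" "y = ?xs ! j"
        unfolding in_set_conv_nth by blast
      moreover have "last ?xs = ?xs ! (length ?xs - 1)"
        using \<open>?xs \<noteq> []\<close> by (rule last_conv_nth)
      ultimately show ?thesis by (simp add: sorted_nth_mono)
    qed
    show "last ?xs \<in> gaps H"
      using last_in_set[OF \<open>?xs \<noteq> []\<close>] assms(1) by simp
  qed (fact assms(1))
  finally show ?thesis .
qed

text \<open>If some gap lay above \<open>x\<close>, the first such gap would be at least
  \<open>x + 3 - 1 = x + 2\<close>, while the gap preceding it is at most \<open>x - 1\<close>: a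
  leap of at least 3.\<close>

lemma sparse_semigroup_no_consecutive:
  assumes "sparse_semigroup H" and "x \<in> H" and "Suc x \<in> H" and "f \<in> gaps H"
  shows "f < x"
proof (rule ccontr)
  assume "\<not> f < x"
  have ns: "numerical_semigroup H"
    and leap: "\<And>i. i \<in> {2..genus H} \<Longrightarrow> gap H i - gap H (i - 1) \<le> 2"
    using assms(1) by (auto simp: sparse_semigroup_def)
  have fin: "finite (gaps H)" using ns by (simp add: numerical_semigroup_def gaps_def)
  define xs where "xs = sorted_list_of_set (gaps H)"
  have set_xs: "set xs = gaps H" and len: "length xs = genus H"
    using fin by (simp_all add: xs_def genus_def)
  \<comment> \<open>Since 1 is then a gap below \<open>x\<close>, the first gap above
    \<open>x\<close> has a predecessor, and the index \<open>i - 1\<close> does not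
    truncate.\<close>
  have one: "1 \<notin> H"
  proof
    assume "1 \<in> H"
    have "y \<in> H" for y
    proof (induction y)
      case (Suc y)
      then have "y + 1 \<in> H" using ns \<open>1 \<in> H\<close> unfolding numerical_semigroup_def by blast
      then show ?case by simp
    qed (use ns in \<open>simp add: numerical_semigroup_def\<close>)
    with assms(4) show False by (simp add: gaps_def)
  qed
  then have "0 < x" "x \<noteq> 1" using assms(2,3) by (auto intro: gr0I)
  define P where "P i \<longleftrightarrow> i < length xs \<and> x < xs ! i" for i
  define i where "i = (LEAST i. P i)"
  obtain j where j: "j < length xs" "xs ! j = f"
    using assms(4) set_xs by (metis in_set_conv_nth)
  have "f \<noteq> x" using assms(2,4) by (auto simp: gaps_def)
  with j \<open>\<not> f < x\<close> have "P j" by (auto simp: P_def)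
  then have Pi: "P i" unfolding i_def by (rule LeastI)
  obtain j1 where j1: "j1 < length xs" "xs ! j1 = 1"
    using one set_xs by (metis Diff_iff UNIV_I gaps_def in_set_conv_nth)
  have "i \<noteq> 0"
  proof
    assume "i = 0"
    then have "xs ! 0 \<le> xs ! j1"
      using j1(1) by (intro sorted_nth_mono) (auto simp: xs_def)
    with j1 Pi \<open>i = 0\<close> \<open>0 < x\<close> show False by (simp add: P_def)
  qed
  then have "i - 1 < (LEAST i. P i)" by (simp add: i_def)
  then have "\<not> P (i - 1)" by (rule not_less_Least)
  with Pi have lo: "xs ! (i - 1) \<le> x" by (auto simp: P_def)
  have mem: "xs ! i \<in> gaps H" using Pi set_xs by (auto simp: P_def)
  have "xs ! (i - 1) \<in> gaps H"
    using Pi set_xs by (metis P_def less_imp_diff_less nth_mem)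
  then have "xs ! (i - 1) \<noteq> x" "xs ! i \<noteq> Suc x"
    using mem assms(2,3) by (auto simp: gaps_def)
  moreover have "xs ! i - xs ! (i - 1) \<le> 2"
    using leap[of "Suc i"] Pi \<open>i \<noteq> 0\<close> by (auto simp: gap_def xs_def[symmetric] P_def len)
  ultimately show False using lo Pi by (auto simp: P_def)
qed

lemma numerical_semigroup_mult_mem:
  assumes "numerical_semigroup H" and "n \<in> H"
  shows "k * n \<in> H"
  by (induction k) (use assms in \<open>auto simp: numerical_semigroup_def\<close>)

lemma semigroup_multiplicity_props:
  assumes "numerical_semigroup H"
  shows "semigroup_multiplicity H \<in> H" and "0 < semigroup_multiplicity H"
    and "\<And>x. x \<in> H \<Longrightarrow> 0 < x \<Longrightarrow> semigroup_multiplicity H \<le> x"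
proof -
  have fin: "finite (UNIV - H)" using assms by (simp add: numerical_semigroup_def)
  then obtain y where y: "\<forall>x\<in>UNIV - H. x \<le> y" by (auto simp: finite_nat_set_iff_bounded_le)
  then have "Suc y \<in> H" by (metis DiffI UNIV_I not_less_eq_eq order_refl)
  then have "semigroup_multiplicity H \<in> H \<and> 0 < semigroup_multiplicity H"
    using LeastI[of "\<lambda>n. n \<in> H \<and> 0 < n" "Suc y"] by (simp add: semigroup_multiplicity_def)
  then show "semigroup_multiplicity H \<in> H" "0 < semigroup_multiplicity H" by auto
  show "\<And>x. x \<in> H \<Longrightarrow> 0 < x \<Longrightarrow> semigroup_multiplicity H \<le> x"
    unfolding semigroup_multiplicity_def by (rule Least_le) simp
qed

lemma card_even_atMost_odd: "card {x \<in> {..2 * k + 1}. even x} = k + 1" for k :: nat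
proof -
  have "{x \<in> {..2 * k + 1}. even x} = (\<lambda>i. 2 * i) ` {..k}"
    by (auto elim!: evenE)
  then show ?thesis by (simp add: card_image inj_on_def)
qed

text \<open>Here \<open>count\<close> expresses the density one third. For
  \<open>F = 6 * r + 1\<close> and \<open>2 * r + 1\<close> nongaps it holds with equality. The
  proof plays two bounds on the number of nongaps up to \<open>z\<close> against each other.\<close>

lemma even_nongaps:
  assumes ns: "numerical_semigroup H"
    and sparse: "\<And>x. x \<in> H \<Longrightarrow> Suc x \<in> H \<Longrightarrow> F < x"
    and F: "F \<notin> H" "\<And>x. x \<notin> H \<Longrightarrow> x \<le> F" "odd F"
    and count: "F + 2 \<le> 3 * card (H \<inter> {..F})"
    and even_mult: "even (semigroup_multiplicity H)"
    and h: "h \<in> H" "h < F"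
  shows "even h"
proof (rule ccontr)
  assume odd: "odd h"
  have zero: "0 \<in> H" and add: "\<And>x y. x \<in> H \<Longrightarrow> y \<in> H \<Longrightarrow> x + y \<in> H"
    using ns by (auto simp: numerical_semigroup_def)
  define n where "n = semigroup_multiplicity H"
  have n: "n \<in> H" "0 < n" and n_le: "\<And>x. x \<in> H \<Longrightarrow> 0 < x \<Longrightarrow> n \<le> x"
    using semigroup_multiplicity_props[OF ns] by (auto simp: n_def)
  obtain m where m: "n = 2 * m" using even_mult by (auto simp: n_def elim: evenE)
  have shift: "h + k * n \<in> H" for k
    using add[OF h(1) numerical_semigroup_mult_mem[OF ns n(1)]] .
  \<comment> \<open>With multiplicity 2 the odd nongap \<open>h\<close> would reach the odd gap
    \<open>F\<close> by steps of 2.\<close>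
  have "n \<noteq> 2"
  proof
    assume "n = 2"
    have "even (F - h)" using odd F(3) h(2) by simp
    then have "h + ((F - h) div 2) * 2 = F" using h(2) by simp
    then show False using shift[of "(F - h) div 2"] \<open>n = 2\<close> F(1) by simp
  qed
  then have n4: "4 \<le> n" using n(2) m by presburger
  define C where "C = H \<union> Suc ` H"
  have HC: "x + c \<in> C" if "x \<in> H" "c \<in> C" for x c
    using that add by (auto simp: C_def)
  define Z where "Z = {z. z \<le> F \<and> z \<notin> C}"
  have finZ: "finite Z" unfolding Z_def by simp
  have C_pred: "x \<in> C \<longleftrightarrow> x \<in> H \<or> x - 1 \<in> H" if "0 < x" for x
    using that by (cases x) (auto simp: C_def)
  have "n - 1 \<notin> H" "n - 1 - 1 \<notin> H" using n_le[of "n - 1"] n_le[of "n - 1 - 1"] n4 by linarith+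
  then have "n - 1 \<notin> C" using C_pred[of "n - 1"] n4 by simp
  with F(2)[OF \<open>n - 1 \<notin> H\<close>] have nZ: "n - 1 \<in> Z" by (simp add: Z_def)
  define z where "z = Max Z"
  have z: "z \<in> Z" unfolding z_def using finZ nZ by (intro Max_in) auto
  then have zF: "z \<le> F" and zC: "z \<notin> C" by (auto simp: Z_def)
  have above: "x \<in> C" if "z < x" "x \<le> F" for x
  proof (rule ccontr)
    assume "x \<notin> C"
    then have "x \<le> z" unfolding z_def using finZ that by (intro Max_ge) (auto simp: Z_def)
    with that show False by simp
  qed
  \<comment> \<open>Descending from the odd gap \<open>F\<close>: \<open>Suc x \<in> C\<close>
    forbids two adjacent gaps and sparseness two adjacent nongaps, so membership flips at each
    step.\<close>
  have alt: "x \<in> H \<longleftrightarrow> even x" if "z \<le> x" "x \<le> F" for x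
    using that(2,1)
  proof (induction rule: inc_induct)
    case base
    then show ?case using F by simp
  next
    case (step x)
    have "Suc x \<in> C" using above step by simp
    then have "x \<in> H \<longleftrightarrow> Suc x \<notin> H" using sparse[of x] step.hyps by (auto simp: C_def)
    then show ?case using step by simp
  qed
  have "z \<notin> H" using zC by (simp add: C_def)
  then have "odd z" using alt[of z] zF by simp
  then obtain k where k: "F = z + 2 * k"
  proof -
    have "even (F - z)" using \<open>odd z\<close> F(3) zF by simp
    then have "F = z + 2 * ((F - z) div 2)" using zF by simp
    then show thesis by (rule that)
  qed
  have "h < z" using alt[of h] h odd by (meson less_imp_le_nat not_le_imp_less)
  have "0 < h" using odd by (auto intro: gr0I)
  then have "n \<le> h" using n_le h(1) by blast
  then have nz: "n \<le> z" using \<open>h < z\<close> by simp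
  \<comment> \<open>Otherwise \<open>[z, F]\<close> has length at least \<open>n\<close>, so the
    largest \<open>h + j * n\<close> up to \<open>F\<close> lies in it. This number is an odd
    nongap, against \<open>alt\<close>.\<close>
  have "k < m"
  proof (rule ccontr)
    assume "\<not> k < m"
    then have "z + n \<le> F" using k m by simp
    define j where "j = (F - h) div n"
    have "j * n \<le> F - h" "F - h < j * n + n"
      using dividend_less_div_times[OF n(2), of "F - h"] by (simp_all add: j_def add.commute)
    then have "z \<le> h + j * n" "h + j * n \<le> F"
      using \<open>z + n \<le> F\<close> h(2) by linarith+
    then have "even (h + j * n)" using alt shift by blast
    then show False using odd m by simp
  qed
  have no_cons: "Suc x \<notin> H" if "x \<in> H" "x \<le> F" for x using sparse[of x] that by auto
  define a where "a = card (H \<inter> {..z})"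
  have "card (H \<inter> {z + 1..<z + 1 + 2 * k}) \<le> k"
    by (rule card_no_consecutive_le[where a = "z + 1"]) (use no_cons k in auto)
  moreover have "H \<inter> {..F} = (H \<inter> {..z}) \<union> (H \<inter> {z + 1..<z + 1 + 2 * k})"
    using k by auto
  ultimately have a1: "card (H \<inter> {..F}) \<le> a + k"
    using card_Un_le[of "H \<inter> {..z}" "H \<inter> {z + 1..<z + 1 + 2 * k}"] by (simp add: a_def)
  have "z - 1 \<notin> H"
    using zC C_pred[of z] nz n(2) by simp
  \<comment> \<open>As \<open>z\<close> and \<open>z - 1\<close> are both gaps, only the lower
    \<open>n - 2 = 2 * (m - 1)\<close> places of the window can hold nongaps.\<close>
  have window: "card (H \<inter> {z - n<..z}) \<le> m - 1"
  proof (rule card_no_consecutive_le[where a = "z - n + 1"])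
    have "x < z - 1" if "x \<in> H" "x \<le> z" for x
    proof -
      have "x \<noteq> z" "x \<noteq> z - 1" using that \<open>z \<notin> H\<close> \<open>z - 1 \<notin> H\<close> by auto
      with that(2) show ?thesis by linarith
    qed
    moreover have "z - n + 1 + 2 * (m - 1) = z - 1" using m n4 nz by simp
    ultimately show "H \<inter> {z - n<..z} \<subseteq> {z - n + 1..<z - n + 1 + 2 * (m - 1)}" by auto
  qed (use no_cons zF in auto)
  define b where "b = card (H \<inter> {..z - n})"
  have "H \<inter> {..z} = (H \<inter> {..z - n}) \<union> (H \<inter> {z - n<..z})" by auto
  then have a2: "a \<le> b + (m - 1)"
    using window card_Un_le[of "H \<inter> {..z - n}" "H \<inter> {z - n<..z}"] by (simp add: a_def b_def)
  define c where "c = card (H \<inter> {n..z})"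
  have "H \<inter> {..z} = insert 0 (H \<inter> {n..z})" using n_le zero by (auto intro: gr0I)
  then have a3: "a = Suc c" unfolding a_def c_def using n(2) by simp
  \<comment> \<open>Each nongap in \<open>[n, z]\<close> contributes itself and its successor to
    \<open>C\<close>. The successor stays within \<open>z\<close> because \<open>z\<close> is a
    gap.\<close>
  have "H \<inter> {n..z} \<inter> Suc ` (H \<inter> {n..z}) = {}"
    using no_cons zF by auto
  then have "card (H \<inter> {n..z} \<union> Suc ` (H \<inter> {n..z})) = 2 * c"
    by (subst card_Un_disjoint) (auto simp: c_def card_image)
  moreover have "H \<inter> {n..z} \<union> Suc ` (H \<inter> {n..z}) \<subseteq> C \<inter> {n..z}"
    using \<open>z \<notin> H\<close> by (auto simp: C_def Suc_le_eq nat_less_le)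
  ultimately have "2 * c \<le> card (C \<inter> {n..z})"
    by (metis card_mono finite_Int finite_atLeastAtMost)
  also have "\<dots> = card ((\<lambda>x. z - x) ` (C \<inter> {n..z}))"
    by (intro card_image[symmetric]) (auto simp: inj_on_def)
  finally have "b + 2 * c \<le> card (H \<inter> {..z - n}) + card ((\<lambda>x. z - x) ` (C \<inter> {n..z}))"
    by (simp add: b_def)
  also have "\<dots> = card (H \<inter> {..z - n} \<union> (\<lambda>x. z - x) ` (C \<inter> {n..z}))"
  proof (rule card_Un_disjoint[symmetric])
    have False if "z - x \<in> H" "x \<in> C" "x \<le> z" for x
      using HC[OF that(1,2)] that(3) zC by simp
    then show "H \<inter> {..z - n} \<inter> (\<lambda>x. z - x) ` (C \<inter> {n..z}) = {}" by auto
  qed auto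
  also have "\<dots> \<le> card {..z - n}"
    by (rule card_mono) auto
  finally have "b + 2 * c \<le> z - n + 1" by simp
  \<comment> \<open>The disjointness bound with \<open>a2\<close>, \<open>a3\<close> gives
    \<open>3 * a \<le> z - m + 2\<close>, whereas \<open>count\<close> with \<open>a1\<close> gives
    \<open>z - k + 2 \<le> 3 * a\<close>. Hence \<open>m \<le> k\<close>.\<close>
  with a1 a2 a3 count k m nz n4 \<open>k < m\<close> show False by linarith
qed

theorem theorem3p8:
  fixes H :: "nat set" and g r :: nat
  assumes "limit_sparse_semigroup H"
    and "genus H = g"
    and "g \<ge> 1"
    and "int (frobenius_number H) = 2 * int g - (2 * int r + 1)"
    and "frobenius_number H = 6 * r + 1"
    and "even (semigroup_multiplicity H)"
  shows "(\<forall>h\<in>H. h < frobenius_number H \<longrightarrow> even h) \<and> hyperelliptic_semigroup r H"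
proof -
  let ?F = "frobenius_number H"
  have sp: "sparse_semigroup H" using assms(1) by (simp add: limit_sparse_semigroup_def)
  then have ns: "numerical_semigroup H" by (simp add: sparse_semigroup_def)
  have fin: "finite (gaps H)" using ns by (simp add: numerical_semigroup_def gaps_def)
  have g: "card (gaps H) = 4 * r + 1" using assms(2,4,5) by (simp add: genus_def)
  then have ne: "gaps H \<noteq> {}" by auto
  note F_Max = frobenius_number_eq_Max[OF fin ne]
  have F_gap: "?F \<in> gaps H" unfolding F_Max using fin ne by (rule Max_in)
  have le_F: "x \<le> ?F" if "x \<notin> H" for x
    unfolding F_Max using fin that by (intro Max_ge) (auto simp: gaps_def)
  \<comment> \<open>Of the \<open>6 * r + 2\<close> integers up to \<open>?F\<close>,
    \<open>4 * r + 1\<close> are gaps.\<close>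
  have "H \<inter> {..?F} = {..?F} - gaps H" by (auto simp: gaps_def)
  moreover have "gaps H \<subseteq> {..?F}" using le_F by (auto simp: gaps_def)
  ultimately have count: "card (H \<inter> {..?F}) = 2 * r + 1"
    using g assms(5) fin by (simp add: card_Diff_subset)
  have main: "even h" if "h \<in> H" "h < ?F" for h
  proof (rule even_nongaps[OF ns, of ?F])
    show "?F < x" if "x \<in> H" "Suc x \<in> H" for x
      using sparse_semigroup_no_consecutive[OF sp that F_gap] .
  qed (use le_F F_gap count assms(5,6) that in \<open>auto simp: gaps_def\<close>)
  \<comment> \<open>All \<open>2 * r + 1\<close> nongaps up to \<open>?F\<close> are among the
    \<open>3 * r + 1\<close> even numbers there, which leaves \<open>r\<close> even gaps.\<close>
  have "{x \<in> gaps H. even x} = {x \<in> {..2 * (3 * r) + 1}. even x} - H \<inter> {..?F}"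
    using le_F assms(5) by (auto simp: gaps_def)
  moreover have "H \<inter> {..?F} \<subseteq> {x \<in> {..2 * (3 * r) + 1}. even x}"
    using main F_gap assms(5) by (auto simp: gaps_def le_less)
  ultimately have "card {x \<in> gaps H. even x} = r"
    using card_even_atMost_odd[of "3 * r"] count by (simp add: card_Diff_subset)
  then show ?thesis using main ns by (simp add: hyperelliptic_semigroup_def)
qed

end
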